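(* Let $R,Q$ be probability distributions on $\mathbb{R}$ with $Q\ll R$ and $\frac{dQ}{dR}(x)<\infty$ for all $x\in\mathbb{R}$, let $c\in(0,1)$ be fixed and $\tau_n=\lfloor cn\rfloor$. Let $\{X_{n,j}\}_{n\in\mathbb{N},1\le j\le n}$ be a triangular array such that for every $n$, $X_{n,1},\dots,X_{n,\tau_n}$ are i.i.d. from $R$, $X_{n,\tau_n+1},\dots,X_{n,n}$ are i.i.d. from $Q$, and $(X_{n,1},\dots,X_{n,\tau_n})$ is independent of $(X_{n,\tau_n+1},\dots,X_{n,n})$. Assume there exists $\delta\in(0,1)$ such that: (i) the $\delta$-th quantile of the mixture distribution $cR+(1-c)Q$ is unique (denote it $q_{\delta,c}$), and $R$ is continuous at $q_{\delta,c}$; (ii) $\mathbb{E}_{Z\sim Q}\left[\frac{dQ}{dR}(Z)\right]<\infty$ and $\mu\ne1$, where $$\mu=\frac{\frac{c}{\delta}R(q_{\delta,c})\,\mathbb{E}_{Z\sim R}\left[\frac{dQ}{dR}(Z)\right]+\left(1-\frac{c}{\delta}R(q_{\delta,c})\right)\mathbb{E}_{Z\sim Q}\left[\frac{dQ}{dR}(Z)\right]}{c\,\mathbb{E}_{Z\sim R}\left[\frac{dQ}{dR}(Z)\right]+(1-c)\,\mathbb{E}_{Z\sim Q}\left[\frac{dQ}{dR}(Z)\right]}.$$ Let $\lambda_1,\lambda_2,\dots$ be i.i.d. $U(0,1)$, with $\{\lambda_n\}_{n\in\mathbb{N}}$ independent of the array, and define $$p_n:=\frac{\sum_{i=1}^n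 \mathbf{1}(X_{n,i}<X_{n,n})+\lambda_n\sum_{i=1}^n\mathbf{1}(X_{n,i}=X_{n,n})}{n}.$$ Let $F_{p_n}$ be the conditional CDF of $p_n$ given the unordered collection (multiset) $\{X_{n,i}\}_{i=1}^n$, equivalently given the order statistics of the $n$-th row. Then $$\liminf_{n\to\infty}\ \sup_{t\in[0,1]}\left|F_{p_n}(t)-t\right|>0\quad\text{almost surely}.$$
   Context: The symbols $R,Q$ denote both distributions and their CDFs, so $R(q)$ is the value of the CDF of $R$ at $q$. $Q\ll R$ means absolute continuity and $\frac{dQ}{dR}$ is the Radon–Nikodym derivative. All rows of the array and the variables $\lambda_n$ live on a common probability space. *)

theory Defs
  imports "HOL-Probability.Probability"
begin

definition mixture :: "real \<Rightarrow> real measure \<Rightarrow> real measure \<Rightarrow> real measure" where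
  "mixture c R Q = measure_of UNIV (sets borel)
     (\<lambda>A. ennreal c * emeasure R A + ennreal (1 - c) * emeasure Q A)"

(* The set function above is countably additive, so measure_of does not collapse
   to the zero measure. *)
lemma emeasure_mixture:
  assumes "sets R = sets borel" "sets Q = sets borel" "A \<in> sets borel"
  shows "emeasure (mixture c R Q) A = ennreal c * emeasure R A + ennreal (1 - c) * emeasure Q A"
  unfolding mixture_def
proof (rule emeasure_measure_of_sigma)
  show "sigma_algebra (UNIV :: real set) (sets borel)"
    using sets.sigma_algebra_axioms[of "borel :: real measure"] by simp
  show "positive (sets borel) (\<lambda>A. ennreal c * emeasure R A + ennreal (1 - c) * emeasure Q A)"
    by (simp add: positive_def)
  show "countably_additive (sets borel)
      (\<lambda>A. ennreal c * emeasure R A + ennreal (1 - c) * emeasure Q A)"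
  proof (rule countably_additiveI)
    fix B :: "nat \<Rightarrow> real set"
    assume B: "range B \<subseteq> sets borel" "disjoint_family B"
    show "(\<Sum>i. ennreal c * emeasure R (B i) + ennreal (1 - c) * emeasure Q (B i))
        = ennreal c * emeasure R (\<Union>i. B i) + ennreal (1 - c) * emeasure Q (\<Union>i. B i)"
      using suminf_emeasure[of B R] suminf_emeasure[of B Q] B assms
      by (simp add: suminf_add[symmetric])
  qed
qed (use assms in auto)

(* Set-valued notion of quantile, so that uniqueness is a genuine condition. *)
definition is_quantile :: "real measure \<Rightarrow> real \<Rightarrow> real \<Rightarrow> bool" where
  "is_quantile P \<delta> x \<longleftrightarrow> \<delta> \<le> measure P {..x} \<and> 1 - \<delta> \<le> measure P {x..}"

definition tau :: "real \<Rightarrow> nat \<Rightarrow> nat" where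
  "tau c n = nat \<lfloor>c * real n\<rfloor>"

definition change_point_array ::
  "'a measure \<Rightarrow> real measure \<Rightarrow> real measure \<Rightarrow> real \<Rightarrow> (nat \<Rightarrow> nat \<Rightarrow> 'a \<Rightarrow> real) \<Rightarrow> bool" where
  "change_point_array M R Q c X \<longleftrightarrow> (\<forall>n\<ge>1.
     prob_space.indep_vars M (\<lambda>_. borel) (X n) {1..tau c n} \<and>
     (\<forall>j\<in>{1..tau c n}. distr M borel (X n j) = R) \<and>
     prob_space.indep_vars M (\<lambda>_. borel) (X n) {tau c n + 1..n} \<and>
     (\<forall>j\<in>{tau c n + 1..n}. distr M borel (X n j) = Q) \<and>
     prob_space.indep_var M
       (Pi\<^sub>M {1..tau c n} (\<lambda>_. borel)) (\<lambda>\<omega>. \<lambda>j\<in>{1..tau c n}. X n j \<omega>)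
       (Pi\<^sub>M {tau c n + 1..n} (\<lambda>_. borel)) (\<lambda>\<omega>. \<lambda>j\<in>{tau c n + 1..n}. X n j \<omega>))"

definition iid_uniform_randomizers :: "'a measure \<Rightarrow> (nat \<Rightarrow> 'a \<Rightarrow> real) \<Rightarrow> bool" where
  "iid_uniform_randomizers M L \<longleftrightarrow>
     prob_space.indep_vars M (\<lambda>_. borel) L {1..} \<and>
     (\<forall>n\<ge>1. distr M borel (L n) = uniform_measure lborel {0<..<1})"

definition randomizers_indep_array ::
  "'a measure \<Rightarrow> (nat \<Rightarrow> 'a \<Rightarrow> real) \<Rightarrow> (nat \<Rightarrow> nat \<Rightarrow> 'a \<Rightarrow> real) \<Rightarrow> bool" where
  "randomizers_indep_array M L X \<longleftrightarrow>
     prob_space.indep_set M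
       (sets (vimage_algebra (space M) (\<lambda>\<omega>. \<lambda>n\<in>{1..}. L n \<omega>) (Pi\<^sub>M {1..} (\<lambda>_. borel))))
       (sets (vimage_algebra (space M) (\<lambda>\<omega>. \<lambda>(n, j)\<in>{(n, j). 1 \<le> j \<and> j \<le> n}. X n j \<omega>)
         (Pi\<^sub>M {(n, j). 1 \<le> j \<and> j \<le> n} (\<lambda>_. borel))))"

definition p_value ::
  "(nat \<Rightarrow> nat \<Rightarrow> 'a \<Rightarrow> real) \<Rightarrow> (nat \<Rightarrow> 'a \<Rightarrow> real) \<Rightarrow> nat \<Rightarrow> 'a \<Rightarrow> real" where
  "p_value X L n \<omega> =
     ((\<Sum>i=1..n. of_bool (X n i \<omega> < X n n \<omega>))
       + L n \<omega> * (\<Sum>i=1..n. of_bool (X n i \<omega> = X n n \<omega>))) / real n"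

(* The k-th smallest entry of row n, with k counted from 0. *)
definition order_stat ::
  "(nat \<Rightarrow> nat \<Rightarrow> 'a \<Rightarrow> real) \<Rightarrow> nat \<Rightarrow> nat \<Rightarrow> 'a \<Rightarrow> real" where
  "order_stat X n k \<omega> = sort (map (\<lambda>i. X n i \<omega>) [1..<n + 1]) ! k"

(* The information carried by the multiset of the entries of row n. *)
definition order_stat_algebra ::
  "'a measure \<Rightarrow> (nat \<Rightarrow> nat \<Rightarrow> 'a \<Rightarrow> real) \<Rightarrow> nat \<Rightarrow> 'a measure" where
  "order_stat_algebra M X n =
     vimage_algebra (space M) (\<lambda>\<omega>. \<lambda>k\<in>{..<n}. order_stat X n k \<omega>) (Pi\<^sub>M {..<n} (\<lambda>_. borel))"

(* F is a regular version of the conditional CDF of Y given G: conditional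
   probabilities are only determined almost surely for each single t, so a supremum
   over t is meaningful only for versions that are genuine CDFs in t. *)
definition is_cond_cdf ::
  "'a measure \<Rightarrow> 'a measure \<Rightarrow> ('a \<Rightarrow> real) \<Rightarrow> ('a \<Rightarrow> real \<Rightarrow> real) \<Rightarrow> bool" where
  "is_cond_cdf M G Y F \<longleftrightarrow>
     (\<forall>\<omega>\<in>space M. \<exists>\<nu>. real_distribution \<nu> \<and> F \<omega> = cdf \<nu>) \<and>
     (\<forall>t. (\<lambda>\<omega>. F \<omega> t) \<in> borel_measurable G \<and>
       (AE \<omega> in M. F \<omega> t = real_cond_exp M G (indicator {\<omega> \<in> space M. Y \<omega> \<le> t}) \<omega>))"

(* D is a version of dQ/dR.  The library's RN_deriv is one fixed, arbitrarily chosen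
   version, which need not be the one that is finite everywhere. *)
definition is_RN_version :: "real measure \<Rightarrow> real measure \<Rightarrow> (real \<Rightarrow> ennreal) \<Rightarrow> bool" where
  "is_RN_version R Q D \<longleftrightarrow>
     D \<in> borel_measurable borel \<and> (AE x in R. D x = RN_deriv R Q x)"

definition mu ::
  "real measure \<Rightarrow> real measure \<Rightarrow> (real \<Rightarrow> ennreal) \<Rightarrow> real \<Rightarrow> real \<Rightarrow> real \<Rightarrow> real" where
  "mu R Q D c \<delta> q =
     (let ER = enn2real (\<integral>\<^sup>+ z. D z \<partial>R); EQ = enn2real (\<integral>\<^sup>+ z. D z \<partial>Q)
      in (c / \<delta> * cdf R q * ER + (1 - c / \<delta> * cdf R q) * EQ) / (c * ER + (1 - c) * EQ))"

end

theory Submission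
  imports Defs
begin

text \<open>
  Since the expectation of \<open>dQ/dR\<close> under \<open>R\<close> is 1, the hypothesis \<open>\<mu> \<noteq> 1\<close> forces \<open>R(q) \<noteq> \<delta>\<close>, and
  since \<open>\<delta> = c R(q) + (1 - c) Q(q)\<close> also \<open>Q(q) \<noteq> \<delta>\<close>. Up to an exponentially unlikely event on which the
  number of entries of the \<open>n\<close>-th row below \<open>q\<close> is far from \<open>\<delta> n\<close>, the event \<open>p\<^sub>n \<le> \<delta> \<mp> 3\<epsilon>\<close> is
  contained in, respectively contains, \<open>X\<^sub>n\<^sub>,\<^sub>n \<le> q\<close>. Given the multiset of the row, the entries after
  the change point are exchangeable, so the conditional probability of \<open>X\<^sub>n\<^sub>,\<^sub>n \<le> q\<close> is the
  conditional expectation of their empirical CDF at \<open>q\<close>, which concentrates at \<open>Q(q)\<close> by Hoeffding's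
  inequality. By Markov and Borel-Cantelli the conditional CDF of \<open>p\<^sub>n\<close> near \<open>\<delta>\<close> therefore stays
  close to \<open>Q(q)\<close>, hence away from the identity.
\<close>

section \<open>Hoeffding bound for the number of entries at most a level\<close>

text \<open>Hoeffding's inequality for indicators with values in [0,1] gives the exponent -2
  (\<epsilon> n)^2 / \<open>card I\<close>. Measuring the deviation against \<open>n\<close> instead
  of \<open>card I\<close> makes the bound geometric in \<open>n\<close>, hence summable and the
  same for both blocks of a row.\<close>

lemma (in prob_space) prob_count_le_Hoeffding:
  fixes X :: "'i \<Rightarrow> 'a \<Rightarrow> real"
  assumes "finite I" and ind: "indep_vars (\<lambda>_. borel) X I"
    and P: "\<And>i. i \<in> I \<Longrightarrow> distr M borel (X i) = P"
    and card: "card I \<le> n" and n: "0 < n" and e: "0 < \<epsilon>"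
  shows "prob {\<omega> \<in> space M. \<bar>(\<Sum>i\<in>I. of_bool (X i \<omega> \<le> q)) - real (card I) * cdf P q\<bar> \<ge> \<epsilon> * real n}
    \<le> 2 * exp (- 2 * \<epsilon>\<^sup>2) ^ n"
\<comment> \<open>The exponent divides by \<open>card I\<close>; for empty \<open>I\<close> the
  event itself is empty, because \<epsilon> n > 0.\<close>
proof (cases "I = {}")
  case True
  then have "{\<omega> \<in> space M. \<bar>(\<Sum>i\<in>I. of_bool (X i \<omega> \<le> q)) - real (card I) * cdf P q\<bar> \<ge> \<epsilon> * real n} = {}"
    using n e by (auto simp: mult_le_0_iff not_le)
  then show ?thesis by (simp only: measure_empty) simp
next
  case False
  have rv [measurable]: "i \<in> I \<Longrightarrow> X i \<in> borel_measurable M" for i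
    using ind by (simp add: indep_vars_def)
  let ?f = "\<lambda>i \<omega>. of_bool (X i \<omega> \<le> q) :: real"
  have ind': "indep_vars (\<lambda>_. borel) ?f I"
    by (rule indep_vars_compose2[OF ind]) simp
  interpret H: Hoeffding_ineq M I ?f "\<lambda>_. 0" "\<lambda>_. 1" "\<Sum>i\<in>I. expectation (?f i)"
    by unfold_locales (use assms(1) ind' in auto)
  have ex: "expectation (?f i) = cdf P q" if "i \<in> I" for i
  proof -
    have "expectation (?f i) = expectation (indicator {\<omega> \<in> space M. X i \<omega> \<le> q})"
      by (rule Bochner_Integration.integral_cong) (auto simp: indicator_def)
    also have "\<dots> = prob {\<omega> \<in> space M. X i \<omega> \<le> q}"
      using that by simp
    also have "\<dots> = measure (distr M borel (X i)) {..q}"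
      using that by (subst measure_distr) (auto intro!: arg_cong[where f=prob])
    finally show ?thesis using P[OF that] by (simp add: cdf_def)
  qed
  have c: "0 < card I" using False assms(1) by (simp add: card_gt_0_iff)
  have "prob {\<omega> \<in> space M. \<bar>(\<Sum>i\<in>I. ?f i \<omega>) - real (card I) * cdf P q\<bar> \<ge> \<epsilon> * real n}
      \<le> 2 * exp (- 2 * (\<epsilon> * real n)\<^sup>2 / real (card I))"
    using H.Hoeffding_ineq_abs_ge[of "\<epsilon> * real n"] e n c by (simp add: ex)
  also have "\<dots> \<le> 2 * exp (real n * (- 2 * \<epsilon>\<^sup>2))"
  proof -
    have "\<epsilon>\<^sup>2 * real n * real (card I) \<le> \<epsilon>\<^sup>2 * real n * real n"
      using card by (intro mult_left_mono) auto
    then have "real n * \<epsilon>\<^sup>2 \<le> (\<epsilon> * real n)\<^sup>2 / real (card I)"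
      using c by (simp add: field_simps power2_eq_square)
    then show ?thesis by simp
  qed
  also have "\<dots> = 2 * exp (- 2 * \<epsilon>\<^sup>2) ^ n"
    by (simp only: exp_of_nat_mult)
  finally show ?thesis .
qed

section \<open>Order statistics: measurability and invariance under relabelling\<close>

text \<open>In a sorted list the entries at most \<open>a\<close> form an initial segment, whose
  length is the number of such entries.\<close>

lemma sorted_nth_le_iff:
  fixes zs :: "'b::linorder list"
  assumes "sorted zs" "k < length zs"
  shows "zs ! k \<le> a \<longleftrightarrow> k < length (filter (\<lambda>x. x \<le> a) zs)"
  using assms
proof (induction zs arbitrary: k)
  case (Cons z zs)
  show ?case
  proof (cases "z \<le> a")
    case True
    then show ?thesis using Cons by (cases k) auto
  next
    case False
    then have "filter (\<lambda>x. x \<le> a) zs = []"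
      using Cons.prems by (auto simp: filter_empty_conv)
    moreover have "z \<le> (z # zs) ! k"
      using Cons.prems by (cases k) auto
    ultimately show ?thesis using False by auto
  qed
qed simp

lemma sort_nth_le_iff:
  fixes xs :: "'b::linorder list"
  assumes "k < length xs"
  shows "sort xs ! k \<le> a \<longleftrightarrow> k < length (filter (\<lambda>x. x \<le> a) xs)"
proof -
  have "length (filter (\<lambda>x. x \<le> a) (sort xs)) = length (filter (\<lambda>x. x \<le> a) xs)"
    by (simp only: size_mset[symmetric] mset_filter mset_sort)
  then show ?thesis using sorted_nth_le_iff[of "sort xs" k a] assms by simp
qed

text \<open>By \<open>sort_nth_le_iff\<close> a sublevel set of an order statistic is the event that
  more than \<open>k\<close> entries are at most \<open>a\<close>, a condition on a finite sum of
  indicators.\<close>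

lemma borel_measurable_sort_nth:
  fixes f :: "'i \<Rightarrow> 'a \<Rightarrow> real"
  assumes f: "\<And>i. i \<in> set xs \<Longrightarrow> f i \<in> borel_measurable N" and k: "k < length xs"
  shows "(\<lambda>\<omega>. sort (map (\<lambda>i. f i \<omega>) xs) ! k) \<in> borel_measurable N"
proof (rule borel_measurable_iff_le[THEN iffD2], rule allI)
  fix a
  have "(\<lambda>\<omega>. real (length (filter (\<lambda>x. x \<le> a) (map (\<lambda>i. f i \<omega>) xs)))) \<in> borel_measurable N"
    using f
  proof (induction xs)
    case (Cons x xs)
    then have [measurable]: "f x \<in> borel_measurable N"
      "(\<lambda>\<omega>. real (length (filter (\<lambda>x. x \<le> a) (map (\<lambda>i. f i \<omega>) xs)))) \<in> borel_measurable N"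
      by auto
    have eq: "(\<lambda>\<omega>. real (length (filter (\<lambda>x. x \<le> a) (map (\<lambda>i. f i \<omega>) (x # xs)))))
      = (\<lambda>\<omega>. of_bool (f x \<omega> \<le> a) + real (length (filter (\<lambda>x. x \<le> a) (map (\<lambda>i. f i \<omega>) xs))))"
      by auto
    show ?case unfolding eq by measurable
  qed simp
  then have "{\<omega> \<in> space N. real k < real (length (filter (\<lambda>x. x \<le> a) (map (\<lambda>i. f i \<omega>) xs)))} \<in> sets N"
    by measurable
  then show "{\<omega> \<in> space N. sort (map (\<lambda>i. f i \<omega>) xs) ! k \<le> a} \<in> sets N"
    using k by (simp add: sort_nth_le_iff)
qed

text \<open>Both lists have the same multiset, so the order statistics do not see a relabelling of
  the row.\<close>

lemma sort_map_permutes: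
  assumes "p permutes {1..n}"
  shows "sort (map (\<lambda>i. f (p i)) [1..<n + 1]) = sort (map f [1..<n + 1])"
proof (rule properties_for_sort)
  have s: "mset [1..<n + 1] = mset_set {1..n}"
    unfolding mset_upt by (rule arg_cong[where f = mset_set]) auto
  have "image_mset p (mset_set {1..n}) = mset_set {1..n}"
    using assms by (metis image_mset_mset_set permutes_image permutes_inj_on)
  then have "image_mset f (image_mset p (mset [1..<n + 1])) = image_mset f (mset [1..<n + 1])"
    by (simp only: s)
  then show "mset (sort (map f [1..<n + 1])) = mset (map (\<lambda>i. f (p i)) [1..<n + 1])"
    by (simp only: mset_sort mset_map multiset.map_comp comp_def)
qed simp

lemma subalgebra_order_stat:
  assumes "\<And>j. j \<in> {1..n} \<Longrightarrow> X n j \<in> borel_measurable M"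
  shows "subalgebra M (order_stat_algebra M X n)"
  unfolding subalgebra_def order_stat_algebra_def
proof (intro conjI)
  show "sets (vimage_algebra (space M) (\<lambda>\<omega>. \<lambda>k\<in>{..<n}. order_stat X n k \<omega>) (Pi\<^sub>M {..<n} (\<lambda>_. borel)))
      \<subseteq> sets M"
  proof (rule sets_image_in_sets[OF refl], rule measurable_restrict)
    show "order_stat X n k \<in> borel_measurable M" if "k \<in> {..<n}" for k
      unfolding order_stat_def by (rule borel_measurable_sort_nth) (use assms that in auto)
  qed
qed simp

section \<open>Exchangeability after the change point\<close>

text \<open>The law of the block is a power of \<open>Q\<close>, which reindexing by
  \<open>p\<close> preserves. The reindexed block is a function of the block, so it is still
  independent of \<open>U\<close>; both pairs then have the same product law.\<close>

lemma (in prob_space) prob_permute_iid_block: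
  fixes Y :: "'i \<Rightarrow> 'a \<Rightarrow> real"
  assumes ind: "indep_vars (\<lambda>_. borel) Y J"
    and Q: "\<And>i. i \<in> J \<Longrightarrow> distr M borel (Y i) = Q"
    and UV: "indep_var N U (Pi\<^sub>M J (\<lambda>_. borel)) (\<lambda>\<omega>. \<lambda>i\<in>J. Y i \<omega>)"
    and p: "p permutes J"
    and C: "C \<in> sets (N \<Otimes>\<^sub>M Pi\<^sub>M J (\<lambda>_. borel))"
  shows "prob {\<omega> \<in> space M. (U \<omega>, \<lambda>i\<in>J. Y (p i) \<omega>) \<in> C} = prob {\<omega> \<in> space M. (U \<omega>, \<lambda>i\<in>J. Y i \<omega>) \<in> C}"
\<comment> \<open>For empty \<open>J\<close> nothing makes \<open>Q\<close> a probability measure,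
  but then the two tuples coincide.\<close>
proof (cases "J = {}")
  case True
  then show ?thesis by (simp add: restrict_def)
next
  case False
  let ?P = "Pi\<^sub>M J (\<lambda>_. borel :: real measure)"
  let ?V = "\<lambda>\<omega>. \<lambda>i\<in>J. Y i \<omega>" and ?V' = "\<lambda>\<omega>. \<lambda>i\<in>J. Y (p i) \<omega>"
  let ?S = "\<lambda>v. \<lambda>i\<in>J. v (p i)"
  have pJ: "p i \<in> J" if "i \<in> J" for i using p that by (simp add: permutes_in_image)
  have rv: "i \<in> J \<Longrightarrow> Y i \<in> borel_measurable M" for i
    using ind by (simp add: indep_vars_def)
  have Vm [measurable]: "?V \<in> measurable M ?P" using rv by measurable
  have Sm [measurable]: "?S \<in> measurable ?P ?P"
    by (rule measurable_restrict) (use pJ in auto)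
  have V': "?V' = ?S \<circ> ?V" using pJ by (auto simp: fun_eq_iff)
  have Qp: "prob_space Q"
    using False rv Q by (metis all_not_in_conv prob_space_distr)
  have sQ: "sets Q = sets borel" using False Q by (metis all_not_in_conv sets_distr)
  have dV: "distr M ?P ?V = Pi\<^sub>M J (\<lambda>_. Q)"
    using indep_vars_iff_distr_eq_PiM'[OF False rv, THEN iffD1, OF _ ind] Q by (simp cong: PiM_cong)
  have sP: "sets (Pi\<^sub>M J (\<lambda>_. Q)) = sets ?P"
    using sQ by (intro sets_PiM_cong) auto
  have "distr M ?P ?V' = distr (distr M ?P ?V) ?P ?S"
    unfolding V' by (rule distr_distr[symmetric]) measurable
  also have "\<dots> = distr (Pi\<^sub>M J (\<lambda>_. Q)) (Pi\<^sub>M J (\<lambda>_. Q)) ?S"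
    unfolding dV by (rule distr_cong) (auto simp: sP)
  also have "\<dots> = Pi\<^sub>M J (\<lambda>_. Q)"
    by (rule distr_PiM_reindex) (use Qp p in \<open>auto intro: permutes_inj_on simp: pJ\<close>)
  finally have eq: "distr M ?P ?V' = distr M ?P ?V" by (simp add: dV)
  have UV': "indep_var N U ?P ?V'"
    using indep_var_compose[OF UV measurable_ident Sm] V' by simp
  have [measurable]: "U \<in> measurable M N" using UV by (rule indep_var_rv1)
  have [measurable]: "?V' \<in> measurable M ?P" using UV' by (rule indep_var_rv2)
  have "distr M (N \<Otimes>\<^sub>M ?P) (\<lambda>\<omega>. (U \<omega>, ?V' \<omega>)) = distr M (N \<Otimes>\<^sub>M ?P) (\<lambda>\<omega>. (U \<omega>, ?V \<omega>))"
    using UV UV' unfolding indep_var_distribution_eq eq by metis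
  then have "measure (distr M (N \<Otimes>\<^sub>M ?P) (\<lambda>\<omega>. (U \<omega>, ?V' \<omega>))) C
      = measure (distr M (N \<Otimes>\<^sub>M ?P) (\<lambda>\<omega>. (U \<omega>, ?V \<omega>))) C"
    by simp
  then show ?thesis
    by (subst (asm) (1 2) measure_distr) (use C in \<open>auto simp: vimage_def Int_def conj_commute\<close>)
qed


lemma change_point_array_measurable:
  assumes "change_point_array M R Q c X" "prob_space M" "j \<in> {1..n}"
  shows "X n j \<in> borel_measurable M"
proof -
  interpret prob_space M by fact
  have "indep_vars (\<lambda>_. borel) (X n) {1..tau c n}" "indep_vars (\<lambda>_. borel) (X n) {tau c n + 1..n}"
    using assms unfolding change_point_array_def by auto
  then show ?thesis
    using assms(3) unfolding indep_vars_def by (cases "j \<le> tau c n") auto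
qed

text \<open>Swapping the entries \<open>j\<close> and \<open>n\<close>, both after the change point,
  preserves the joint law of the row and leaves the order statistics, hence \<open>A\<close>,
  unchanged.\<close>

lemma (in prob_space) order_stat_exchangeable:
  assumes cpa: "change_point_array M R Q c X"
    and j: "tau c n < j" "j \<le> n"
    and A: "A \<in> sets (order_stat_algebra M X n)"
  shows "prob (A \<inter> {\<omega> \<in> space M. X n j \<omega> \<le> q}) = prob (A \<inter> {\<omega> \<in> space M. X n n \<omega> \<le> q})"
proof -
  let ?I = "{1..tau c n}" and ?J = "{tau c n + 1..n}"
  let ?N1 = "Pi\<^sub>M ?I (\<lambda>_. borel :: real measure)" and ?N2 = "Pi\<^sub>M ?J (\<lambda>_. borel :: real measure)"
  let ?U = "\<lambda>\<omega>. \<lambda>j\<in>?I. X n j \<omega>"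
  have n: "n \<ge> 1" using j by simp
  have ind: "indep_vars (\<lambda>_. borel) (X n) ?J"
    and Q: "\<And>i. i \<in> ?J \<Longrightarrow> distr M borel (X n i) = Q"
    and UV: "indep_var ?N1 ?U ?N2 (\<lambda>\<omega>. \<lambda>j\<in>?J. X n j \<omega>)"
    using cpa n unfolding change_point_array_def by auto
  define p where "p = Transposition.transpose j n"
  have p: "p permutes ?J"
    unfolding p_def using j by (intro permutes_swap_id) auto
  then have p1: "p permutes {1..n}" by (rule permutes_subset) auto
  have pI: "p i = i" if "i \<in> ?I" for i
    using p that by (auto simp: permutes_def)
  \<comment> \<open>\<open>g\<close> glues the two blocks into one row and \<open>\<Psi>\<close>
    computes its order statistics, so that an event about the row becomes a set \<open>C\<close> in
    the product of the block spaces.\<close>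
  define g :: "(nat \<Rightarrow> real) \<times> (nat \<Rightarrow> real) \<Rightarrow> nat \<Rightarrow> real"
    where "g = (\<lambda>z i. if i \<in> ?I then fst z i else snd z i)"
  define \<Psi> where "\<Psi> = (\<lambda>z. \<lambda>k\<in>{..<n}. sort (map (g z) [1..<n + 1]) ! k)"
  have gm: "(\<lambda>z. g z i) \<in> borel_measurable (?N1 \<Otimes>\<^sub>M ?N2)" if "i \<in> {1..n}" for i
  proof (cases "i \<in> ?I")
    case True
    then have "(\<lambda>z. g z i) = (\<lambda>z. fst z i)" by (auto simp: g_def)
    then show ?thesis
      using measurable_compose[OF measurable_fst measurable_component_singleton[OF True]] by (simp only:)
  next
    case False
    then have i: "i \<in> ?J" using that by auto
    have "(\<lambda>z. g z i) = (\<lambda>z. snd z i)" using False by (auto simp: g_def)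
    then show ?thesis
      using measurable_compose[OF measurable_snd measurable_component_singleton[OF i]] by (simp only:)
  qed
  have \<Psi>m [measurable]: "\<Psi> \<in> measurable (?N1 \<Otimes>\<^sub>M ?N2) (Pi\<^sub>M {..<n} (\<lambda>_. borel))"
    unfolding \<Psi>_def
    by (rule measurable_restrict, rule borel_measurable_sort_nth[where f = "\<lambda>i z. g z i"])
      (use gm in auto)
  have nJ: "n \<in> ?J" using j by auto
  then have [measurable]: "(\<lambda>u. u n) \<in> borel_measurable ?N2" by (rule measurable_component_singleton)
  obtain B where [measurable]: "B \<in> sets (Pi\<^sub>M {..<n} (\<lambda>_. borel))"
    and AB: "A = (\<lambda>\<omega>. \<lambda>k\<in>{..<n}. order_stat X n k \<omega>) -` B \<inter> space M"
    using A unfolding order_stat_algebra_def by (subst (asm) sets_vimage_algebra2) (auto simp: space_PiM)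
  define C where "C = {z \<in> space (?N1 \<Otimes>\<^sub>M ?N2). \<Psi> z \<in> B \<and> snd z n \<le> q}"
  have C: "C \<in> sets (?N1 \<Otimes>\<^sub>M ?N2)" unfolding C_def by measurable
  have os: "\<Psi> (?U \<omega>, \<lambda>i\<in>?J. X n (s i) \<omega>) = (\<lambda>k\<in>{..<n}. order_stat X n k \<omega>)"
    if s: "s permutes {1..n}" "\<And>i. i \<in> ?I \<Longrightarrow> s i = i" for s \<omega>
  proof -
    have "map (g (?U \<omega>, \<lambda>i\<in>?J. X n (s i) \<omega>)) [1..<n + 1] = map (\<lambda>i. X n (s i) \<omega>) [1..<n + 1]"
      using s(2) by (auto simp: g_def)
    then show ?thesis
      unfolding \<Psi>_def order_stat_def
      by (simp only: sort_map_permutes[OF s(1), of "\<lambda>i. X n i \<omega>"])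
  qed
  \<comment> \<open>For \<open>s = p\<close> the last coordinate is \<open>X n j\<close>, for
    \<open>s = id\<close> it is \<open>X n n\<close>; by \<open>os\<close> the part \<open>A\<close>
    is the same in both cases.\<close>
  have ev: "{\<omega> \<in> space M. (?U \<omega>, \<lambda>i\<in>?J. X n (s i) \<omega>) \<in> C} = A \<inter> {\<omega> \<in> space M. X n (s n) \<omega> \<le> q}"
    if s: "s permutes {1..n}" "\<And>i. i \<in> ?I \<Longrightarrow> s i = i" for s
    using os[OF s] nJ unfolding C_def AB by (auto simp: space_pair_measure space_PiM)
  have "prob {\<omega> \<in> space M. (?U \<omega>, \<lambda>i\<in>?J. X n (p i) \<omega>) \<in> C} = prob {\<omega> \<in> space M. (?U \<omega>, \<lambda>i\<in>?J. X n i \<omega>) \<in> C}"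
    by (rule prob_permute_iid_block[OF ind Q UV p C])
  then show ?thesis
    using ev[OF p1 pI] ev[of id] by (simp add: p_def permutes_id)
qed

section \<open>Exceptional event for the block counts\<close>

text \<open>The event that some block count is far from its mean. The blocks are controlled
  separately because exchangeability concerns only the second one, while the p-value depends on the
  counts of both.\<close>

definition count_deviation ::
  "'a measure \<Rightarrow> (nat \<Rightarrow> nat \<Rightarrow> 'a \<Rightarrow> real) \<Rightarrow> real measure \<Rightarrow> real measure \<Rightarrow> real \<Rightarrow> real \<Rightarrow> real \<Rightarrow> nat \<Rightarrow> 'a set" where
  "count_deviation M X R Q c q \<epsilon> n =
     {\<omega> \<in> space M. \<epsilon> * real n \<le>
        \<bar>(\<Sum>i\<in>{1..tau c n}. of_bool (X n i \<omega> \<le> q)) - real (card {1..tau c n}) * cdf R q\<bar>} \<union>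
     {\<omega> \<in> space M. \<epsilon> * real n \<le>
        \<bar>(\<Sum>i\<in>{tau c n + 1..n}. of_bool (X n i \<omega> \<le> q)) - real (card {tau c n + 1..n}) * cdf Q q\<bar>}"

lemma tau_le:
  assumes "0 < c" "c < 1"
  shows "real (tau c n) \<le> c * real n" "c * real n - 1 < real (tau c n)" "tau c n \<le> n"
proof -
  have "0 \<le> c * real n" using assms by simp
  then show 1: "real (tau c n) \<le> c * real n" and "c * real n - 1 < real (tau c n)"
    unfolding tau_def by linarith+
  have "c * real n \<le> real n" using assms by (simp add: mult_left_le_one_le)
  then show "tau c n \<le> n" using 1 by linarith
qed

lemma count_deviation_block_measurable:
  fixes X :: "'i \<Rightarrow> 'a \<Rightarrow> real" and a b :: real
  assumes "\<And>i. i \<in> I \<Longrightarrow> X i \<in> borel_measurable M"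
  shows "{\<omega> \<in> space M. a \<le> \<bar>(\<Sum>i\<in>I. of_bool (X i \<omega> \<le> q)) - b\<bar>} \<in> sets M"
proof -
  have "(\<lambda>\<omega>. \<Sum>i\<in>I. of_bool (X i \<omega> \<le> q) :: real) \<in> borel_measurable M"
  proof (rule borel_measurable_sum)
    fix i assume "i \<in> I"
    then have [measurable]: "X i \<in> borel_measurable M" by (rule assms)
    show "(\<lambda>\<omega>. of_bool (X i \<omega> \<le> q) :: real) \<in> borel_measurable M" by measurable
  qed
  note [measurable] = this
  show ?thesis by measurable
qed

lemma (in prob_space) count_deviation_measurable:
  assumes "change_point_array M R Q c X" "0 < c" "c < 1"
  shows "count_deviation M X R Q c q \<epsilon> n \<in> events"
  unfolding count_deviation_def
  by (intro sets.Un count_deviation_block_measurable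
      change_point_array_measurable[OF assms(1) prob_space_axioms])
    (use tau_le(3)[OF assms(2,3), of n] in auto)

lemma (in prob_space) prob_count_deviation:
  assumes cpa: "change_point_array M R Q c X" and c: "0 < c" "c < 1" and n: "0 < n" and e: "0 < \<epsilon>"
  shows "prob (count_deviation M X R Q c q \<epsilon> n) \<le> 4 * exp (- 2 * \<epsilon>\<^sup>2) ^ n"
proof -
  let ?I = "{1..tau c n}" and ?J = "{tau c n + 1..n}"
  let ?A = "{\<omega> \<in> space M. \<epsilon> * real n \<le> \<bar>(\<Sum>i\<in>?I. of_bool (X n i \<omega> \<le> q)) - real (card ?I) * cdf R q\<bar>}"
  let ?B = "{\<omega> \<in> space M. \<epsilon> * real n \<le> \<bar>(\<Sum>i\<in>?J. of_bool (X n i \<omega> \<le> q)) - real (card ?J) * cdf Q q\<bar>}"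
  have *: "indep_vars (\<lambda>_. borel) (X n) ?I" "indep_vars (\<lambda>_. borel) (X n) ?J"
    "\<And>i. i \<in> ?I \<Longrightarrow> distr M borel (X n i) = R" "\<And>i. i \<in> ?J \<Longrightarrow> distr M borel (X n i) = Q"
    using cpa n unfolding change_point_array_def by (auto simp: Suc_le_eq)
  have card: "card ?I \<le> n" "card ?J \<le> n" using tau_le(3)[OF c, of n] by auto
  have "?A \<in> events" "?B \<in> events"
    by (intro count_deviation_block_measurable change_point_array_measurable[OF cpa prob_space_axioms];
        use tau_le(3)[OF c, of n] in auto)+
  then have "prob (?A \<union> ?B) \<le> prob ?A + prob ?B" by (rule measure_Un_le)
  also have "\<dots> \<le> 2 * exp (- 2 * \<epsilon>\<^sup>2) ^ n + 2 * exp (- 2 * \<epsilon>\<^sup>2) ^ n"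
    by (intro add_mono prob_count_le_Hoeffding[OF _ *(1,3) card(1) n e]
        prob_count_le_Hoeffding[OF _ *(2,4) card(2) n e]) auto
  finally show ?thesis unfolding count_deviation_def by simp
qed

section \<open>Conditional probability that the last entry is at most q\<close>

lemma (in finite_measure) integrable_indicator_real:
  "A \<in> sets M \<Longrightarrow> integrable M (indicator A :: _ \<Rightarrow> real)"
  by (rule integrable_real_indicator) (simp_all add: less_top[symmetric])

text \<open>The empirical CDF of the post-change block at \<open>q\<close> is within \<epsilon> / (1
  - c) of Q(q) off the exceptional event and within 1 on it. The factor 1 / (1 - c) arises because
  deviations are measured against \<open>n\<close>, while the block may have only about (1 - c) n
  entries.\<close>

lemma (in prob_space) cond_prob_last_near_cdf:
  assumes cpa: "change_point_array M R Q c X" and c: "0 < c" "c < 1" and n: "1 \<le> n" and e: "0 < \<epsilon>"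
    and Q: "real_distribution Q"
  defines "G \<equiv> order_stat_algebra M X n"
  shows "AE \<omega> in M. \<bar>real_cond_exp M G (indicator {\<omega> \<in> space M. X n n \<omega> \<le> q}) \<omega> - cdf Q q\<bar>
    \<le> \<epsilon> / (1 - c) + real_cond_exp M G (indicator (count_deviation M X R Q c q \<epsilon> n)) \<omega>"
proof -
  interpret Q: real_distribution Q by fact
  let ?B = "count_deviation M X R Q c q \<epsilon> n"
  let ?J = "{tau c n + 1..n}"
  define m where "m = card ?J"
  have mX: "X n j \<in> borel_measurable M" if "j \<in> {1..n}" for j
    using change_point_array_measurable[OF cpa prob_space_axioms that] .
  interpret finite_measure_subalgebra M G
    unfolding G_def by unfold_locales (rule subalgebra_order_stat, rule mX)
  have [measurable]: "?B \<in> events" by (rule count_deviation_measurable[OF cpa c])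
  have mX' [measurable]: "X n j \<in> borel_measurable M" if "j \<in> ?J" for j
    using that mX by auto
  \<comment> \<open>Strictness makes the post-change block nonempty; the floor in \<open>tau\<close>
    can only enlarge it beyond (1 - c) n.\<close>
  have cn: "c * real n < real n" using c n by simp
  have m: "(1 - c) * real n \<le> real m" "0 < m"
    using tau_le[OF c, of n] cn by (auto simp: m_def algebra_simps of_nat_diff)
  have nJ: "n \<in> ?J" using m by (auto simp: m_def)
  let ?E = "\<lambda>j. {\<omega> \<in> space M. X n j \<omega> \<le> q}"
  have E [measurable]: "?E j \<in> events" if "j \<in> ?J" for j using that by measurable
  \<comment> \<open>By exchangeability \<open>Av\<close> has the same conditional expectation as the indicator of \<open>?E n\<close>.\<close>
  define Av where "Av = (\<lambda>\<omega>. (\<Sum>j\<in>?J. indicator (?E j) \<omega>) / real m :: real)"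
  have iAv: "integrable M Av"
    unfolding Av_def using E
    by (intro integrable_divide Bochner_Integration.integrable_sum integrable_indicator_real)
  have "AE \<omega> in M. real_cond_exp M G (indicator (?E n)) \<omega> = real_cond_exp M G Av \<omega>"
  \<comment> \<open>It suffices to compare integrals over \<open>A\<close> in \<open>G\<close>: each
    summand of \<open>Av\<close> contributes \<open>prob (A \<inter> ?E n)\<close>, and the average
    of \<open>m\<close> equal terms is that term.\<close>
  proof (rule real_cond_exp_charact)
    fix A assume A: "A \<in> sets G"
    then have [measurable]: "A \<in> events" using subalg by (auto simp: subalgebra_def)
    have ex: "(\<integral>\<omega>\<in>A. indicator (?E j) \<omega> \<partial>M) = prob (A \<inter> ?E n)" if "j \<in> ?J" for j
    proof -
      have "(\<integral>\<omega>\<in>A. indicator (?E j) \<omega> \<partial>M) = (\<integral>\<omega>. indicator (A \<inter> ?E j) \<omega> \<partial>M)"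
        unfolding set_lebesgue_integral_def
      by (rule Bochner_Integration.integral_cong) (auto simp: indicator_def)
      also have "\<dots> = prob (A \<inter> ?E j)"
        using sets.Int[OF \<open>A \<in> events\<close> E[OF that]]
        by (simp only: Bochner_Integration.integral_indicator sets.Int_space_eq2)
      also have "\<dots> = prob (A \<inter> ?E n)"
        using that by (intro order_stat_exchangeable[OF cpa _ _ A[unfolded G_def]]) auto
      finally show ?thesis .
    qed
    have "(\<integral>\<omega>\<in>A. Av \<omega> \<partial>M) = (\<integral>\<omega>. (\<Sum>j\<in>?J. indicator A \<omega> * indicator (?E j) \<omega>) / real m \<partial>M)"
      unfolding set_lebesgue_integral_def Av_def real_scaleR_def
      by (simp only: times_divide_eq_right sum_distrib_left)
    also have "\<dots> = (\<Sum>j\<in>?J. (\<integral>\<omega>\<in>A. indicator (?E j) \<omega> \<partial>M)) / real m"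
    proof -
      have "integrable M (\<lambda>\<omega>. indicator A \<omega> * indicator (?E j) \<omega> :: real)" if "j \<in> ?J" for j
        unfolding indicator_inter_arith[symmetric]
        by (intro integrable_indicator_real sets.Int \<open>A \<in> events\<close> E[OF that])
      then show ?thesis unfolding set_lebesgue_integral_def real_scaleR_def
        by (simp only: integral_divide_zero Bochner_Integration.integral_sum)
    qed
    also have "\<dots> = prob (A \<inter> ?E n)" using ex m by (simp add: m_def)
    finally show "(\<integral>\<omega>\<in>A. indicator (?E n) \<omega> \<partial>M) = (\<integral>\<omega>\<in>A. real_cond_exp M G Av \<omega> \<partial>M)"
      using ex[OF nJ] real_cond_exp_intA[OF iAv A] by simp
  qed (use iAv integrable_indicator_real[OF E[OF nJ]] in auto)
  moreover have pt: "\<bar>Av \<omega> - cdf Q q\<bar> \<le> \<epsilon> / (1 - c) + indicator ?B \<omega>" if w: "\<omega> \<in> space M" for \<omega>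
  proof (cases "\<omega> \<in> ?B")
    \<comment> \<open>Both numbers lie in [0,1], so the indicator of the exceptional event covers
      their distance.\<close>
    case True
    have "(\<Sum>j\<in>?J. indicator (?E j) \<omega>) \<le> (\<Sum>j\<in>?J. 1 :: real)"
      by (intro sum_mono) (simp add: indicator_def)
    then have "Av \<omega> \<le> 1" using m unfolding Av_def by (simp add: m_def)
    moreover have "0 \<le> Av \<omega>" unfolding Av_def by (simp add: sum_nonneg)
    moreover have "0 \<le> cdf Q q" "cdf Q q \<le> 1" by (simp_all add: cdf_def)
    moreover have "0 \<le> \<epsilon> / (1 - c)" using e c by simp
    ultimately show ?thesis using True by auto
  next
    case False
    have "(\<Sum>i\<in>?J. of_bool (X n i \<omega> \<le> q)) = real m * Av \<omega>"
      using m w by (simp add: Av_def indicator_def)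
    then have "\<bar>real m * Av \<omega> - real m * cdf Q q\<bar> < \<epsilon> * real n"
      using False w unfolding count_deviation_def m_def by auto
    then have "real m * \<bar>Av \<omega> - cdf Q q\<bar> < \<epsilon> * real n"
      by (simp add: right_diff_distrib[symmetric] abs_mult)
    moreover have "(1 - c) * real n * \<bar>Av \<omega> - cdf Q q\<bar> \<le> real m * \<bar>Av \<omega> - cdf Q q\<bar>"
      using m by (intro mult_right_mono) auto
    ultimately have "real n * ((1 - c) * \<bar>Av \<omega> - cdf Q q\<bar>) < real n * \<epsilon>"
      by (simp add: mult_ac)
    then have "(1 - c) * \<bar>Av \<omega> - cdf Q q\<bar> < \<epsilon>"
      by (rule mult_left_less_imp_less) simp
    then show ?thesis using False c by (simp add: field_simps)
  qed
  let ?a = "cdf Q q" and ?d = "\<epsilon> / (1 - c)"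
  have iB: "integrable M (indicator ?B :: _ \<Rightarrow> real)" by (rule integrable_indicator_real) simp
  \<comment> \<open>Conditioning the pointwise bounds from above and below keeps the constants and
    turns the indicator of the exceptional event into its conditional probability.\<close>
  have "AE \<omega> in M. real_cond_exp M G Av \<omega> \<le> real_cond_exp M G (\<lambda>\<omega>. (?a + ?d) + indicator ?B \<omega>) \<omega>"
    by (rule real_cond_exp_mono[OF _ iAv Bochner_Integration.integrable_add[OF integrable_const iB]])
      (use pt in \<open>auto simp: abs_le_iff algebra_simps intro!: AE_I2\<close>)
  moreover have "AE \<omega> in M. real_cond_exp M G (\<lambda>\<omega>. (?a - ?d) - indicator ?B \<omega>) \<omega> \<le> real_cond_exp M G Av \<omega>"
    by (rule real_cond_exp_mono[OF _ Bochner_Integration.integrable_diff[OF integrable_const iB] iAv])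
      (use pt in \<open>auto simp: abs_le_iff algebra_simps intro!: AE_I2\<close>)
  moreover have "AE \<omega> in M. real_cond_exp M G (\<lambda>\<omega>. (?a + ?d) + indicator ?B \<omega>) \<omega>
      = real_cond_exp M G (\<lambda>\<omega>. ?a + ?d) \<omega> + real_cond_exp M G (indicator ?B) \<omega>"
    by (rule real_cond_exp_add[OF integrable_const iB])
  moreover have "AE \<omega> in M. real_cond_exp M G (\<lambda>\<omega>. (?a - ?d) - indicator ?B \<omega>) \<omega>
      = real_cond_exp M G (\<lambda>\<omega>. ?a - ?d) \<omega> - real_cond_exp M G (indicator ?B) \<omega>"
    by (rule real_cond_exp_diff[OF integrable_const iB])
  moreover have "AE \<omega> in M. real_cond_exp M G (\<lambda>\<omega>. ?a + ?d) \<omega> = ?a + ?d"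
    "AE \<omega> in M. real_cond_exp M G (\<lambda>\<omega>. ?a - ?d) \<omega> = ?a - ?d"
    by (auto intro!: real_cond_exp_F_meas)
  ultimately show ?thesis by eventually_elim (auto simp: abs_le_iff)
qed

section \<open>Conditional probabilities of rare events\<close>

text \<open>The conditional probability of \<open>B n\<close> has mean \<open>prob (B n)\<close>, so
  by Markov it reaches \<epsilon> with probability at most \<open>prob (B n) / \<epsilon>\<close>.
  This is summable, and the first Borel-Cantelli lemma applies across rows with arbitrary
  dependence.\<close>

lemma (in prob_space) eventually_real_cond_exp_less:
  assumes G: "\<And>n. subalgebra M (G n)" and B [measurable]: "\<And>n. B n \<in> events"
    and s: "summable (\<lambda>n. prob (B n))" and e: "0 < \<epsilon>"
  shows "AE \<omega> in M. eventually (\<lambda>n. real_cond_exp M (G n) (indicator (B n)) \<omega> < \<epsilon>) sequentially"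
proof -
  let ?Z = "\<lambda>n. real_cond_exp M (G n) (indicator (B n))"
  let ?A = "\<lambda>n. {\<omega> \<in> space M. \<epsilon> \<le> ?Z n \<omega>}"
  have A: "?A n \<in> events" "prob (?A n) \<le> prob (B n) / \<epsilon>" for n
  proof -
    interpret finite_measure_subalgebra M "G n" by unfold_locales (rule G)
    have i: "integrable M (indicator (B n) :: _ \<Rightarrow> real)" by (rule integrable_indicator_real[OF B])
    show "?A n \<in> events" by measurable
    have "AE \<omega> in M. 0 \<le> ?Z n \<omega>" by (rule real_cond_exp_pos) auto
    then have "prob (?A n) \<le> (\<integral>\<omega>. ?Z n \<omega> \<partial>M) / \<epsilon>"
      using real_cond_exp_int(1)[OF i] e
      by (intro integral_Markov_inequality_measure[where A = "space M"]) auto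
    then show "prob (?A n) \<le> prob (B n) / \<epsilon>"
      using real_cond_exp_int(2)[OF i] by simp
  qed
  have "summable (\<lambda>n. prob (?A n))"
    by (rule summable_comparison_test'[OF summable_divide[OF s, of \<epsilon>], of 0]) (use A in auto)
  then have "AE \<omega> in M. eventually (\<lambda>n. \<omega> \<in> space M - ?A n) sequentially"
    by (intro borel_cantelli_AE1) (use A in \<open>auto simp: emeasure_eq_measure\<close>)
  then show ?thesis
    by eventually_elim (auto elim!: eventually_mono)
qed

section \<open>Pathwise comparison of the p-value with the count at q\<close>

text \<open>If the last entry exceeds \<open>q\<close>, every entry at most \<open>q\<close> lies
  strictly below it and has full weight in the p-value; ties only add to it.\<close>

lemma p_value_le_imp:
  assumes "p_value X L n \<omega> \<le> t" "0 \<le> L n \<omega>" "1 \<le> n"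
  shows "X n n \<omega> \<le> q \<or> (\<Sum>i=1..n. of_bool (X n i \<omega> \<le> q)) \<le> t * real n"
proof (cases "X n n \<omega> \<le> q")
  case False
  then have "(\<Sum>i=1..n. of_bool (X n i \<omega> \<le> q)) \<le> (\<Sum>i=1..n. of_bool (X n i \<omega> < X n n \<omega>) :: real)"
    by (intro sum_mono) auto
  moreover have "0 \<le> L n \<omega> * (\<Sum>i=1..n. of_bool (X n i \<omega> = X n n \<omega>))"
    using assms(2) by (intro mult_nonneg_nonneg sum_nonneg) auto
  ultimately show ?thesis
    using assms(1,3) unfolding p_value_def by (simp add: field_simps)
qed simp

text \<open>If the last entry is at most \<open>q\<close>, so are all entries below or tied with it,
  and a tie has weight at most 1.\<close>

lemma p_value_leI:
  assumes "X n n \<omega> \<le> q" "(\<Sum>i=1..n. of_bool (X n i \<omega> \<le> q)) \<le> t * real n" "L n \<omega> \<le> 1" "1 \<le> n"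
  shows "p_value X L n \<omega> \<le> t"
proof -
  have "L n \<omega> * (\<Sum>i=1..n. of_bool (X n i \<omega> = X n n \<omega>)) \<le> 1 * (\<Sum>i=1..n. of_bool (X n i \<omega> = X n n \<omega>))"
    using assms(3) by (intro mult_right_mono sum_nonneg) auto
  moreover have "(\<Sum>i=1..n. of_bool (X n i \<omega> < X n n \<omega>)) + (\<Sum>i=1..n. of_bool (X n i \<omega> = X n n \<omega>))
      \<le> (\<Sum>i=1..n. of_bool (X n i \<omega> \<le> q) :: real)"
    unfolding sum.distrib[symmetric] using assms(1) by (intro sum_mono) auto
  ultimately show ?thesis
    using assms(2,4) unfolding p_value_def by (simp add: field_simps)
qed

text \<open>Three errors of less than \<epsilon> n add up: one from each block, and one from
  replacing \<open>tau c n\<close> by c n. The last is at most 1, whence the condition 1 <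
  \<epsilon> n.\<close>

lemma count_near_mixture_cdf:
  assumes c: "0 < c" "c < 1" and w: "\<omega> \<in> space M" "\<omega> \<notin> count_deviation M X R Q c q \<epsilon> n"
    and R: "real_distribution R" and Q: "real_distribution Q"
    and n: "1 < \<epsilon> * real n"
  shows "\<bar>(\<Sum>i=1..n. of_bool (X n i \<omega> \<le> q)) - (c * cdf R q + (1 - c) * cdf Q q) * real n\<bar> < 3 * \<epsilon> * real n"
proof -
  interpret R: real_distribution R by fact
  interpret Q: real_distribution Q by fact
  let ?f = "\<lambda>i. of_bool (X n i \<omega> \<le> q) :: real"
  note t = tau_le[OF c, of n]
  define S1 S2 where "S1 = (\<Sum>i\<in>{1..tau c n}. ?f i)" and "S2 = (\<Sum>i\<in>{tau c n + 1..n}. ?f i)"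
  have "{1..n} = {1..tau c n} \<union> {tau c n + 1..n}" using t by auto
  then have S: "(\<Sum>i=1..n. ?f i) = S1 + S2"
    unfolding S1_def S2_def by (simp only:) (rule sum.union_disjoint, auto)
  have 1: "\<bar>S1 - real (tau c n) * cdf R q\<bar> < \<epsilon> * real n"
    "\<bar>S2 - (real n - real (tau c n)) * cdf Q q\<bar> < \<epsilon> * real n"
    using w t unfolding count_deviation_def S1_def S2_def by (auto simp: of_nat_diff)
  have "\<bar>cdf R q - cdf Q q\<bar> \<le> 1"
    using R.prob_le_1[of "{..q}"] Q.prob_le_1[of "{..q}"] measure_nonneg[of R "{..q}"] measure_nonneg[of Q "{..q}"]
    unfolding cdf_def by linarith
  then have "\<bar>real (tau c n) - c * real n\<bar> * \<bar>cdf R q - cdf Q q\<bar> \<le> 1 * 1"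
    using t by (intro mult_mono) auto
  then have 2: "\<bar>(real (tau c n) - c * real n) * (cdf R q - cdf Q q)\<bar> < \<epsilon> * real n"
    using n by (simp add: abs_mult)
  have eq: "(S1 + S2) - (c * cdf R q + (1 - c) * cdf Q q) * real n
    = (S1 - real (tau c n) * cdf R q) + (S2 - (real n - real (tau c n)) * cdf Q q)
      + (real (tau c n) - c * real n) * (cdf R q - cdf Q q)"
    by (simp add: algebra_simps)
  have tri: "\<bar>a + b + d\<bar> < 3 * e" if "\<bar>a\<bar> < e" "\<bar>b\<bar> < e" "\<bar>d\<bar> < e" for a b d e :: real
    using that by linarith
  have "\<bar>(S1 + S2) - (c * cdf R q + (1 - c) * cdf Q q) * real n\<bar> < 3 * (\<epsilon> * real n)"
    unfolding eq by (rule tri[OF 1 2])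
  then show ?thesis unfolding S by (simp only: mult.assoc)
qed

section \<open>The quantile level and the value of mu\<close>

text \<open>Continuity removes an atom of \<open>R\<close> at \<open>q\<close>, and absolute
  continuity then removes one of \<open>Q\<close>. Hence the closed half-lines at \<open>q\<close>
  have complementary masses, and the two quantile inequalities become opposite bounds on the same
  number.\<close>

lemma quantile_mixture_eq:
  assumes R: "real_distribution R" and Q: "real_distribution Q" and ac: "absolutely_continuous R Q"
    and c: "0 < c" "c < 1" and q: "is_quantile (mixture c R Q) \<delta> q" and cont: "isCont (cdf R) q"
  shows "\<delta> = c * cdf R q + (1 - c) * cdf Q q"
proof -
  interpret R: real_distribution R by fact
  interpret Q: real_distribution Q by fact
  have R0: "measure R {q} = 0" using cont by (simp add: R.isCont_cdf)
  then have "{q} \<in> null_sets R" by (auto intro!: null_setsI simp: R.emeasure_eq_measure)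
  then have "{q} \<in> null_sets Q" using ac unfolding absolutely_continuous_def by blast
  then have Q0: "measure Q {q} = 0" by (simp add: measure_eq_0_null_sets)
  have mix: "measure (mixture c R Q) A = c * measure R A + (1 - c) * measure Q A" if "A \<in> sets borel" for A
  proof -
    have "emeasure (mixture c R Q) A = ennreal (c * measure R A + (1 - c) * measure Q A)"
      using c that by (simp add: emeasure_mixture R.emeasure_eq_measure Q.emeasure_eq_measure
          ennreal_mult' ennreal_plus)
    then show ?thesis using c by (intro measure_eq_emeasure_eq_ennreal) simp_all
  qed
  have atl: "measure P {q..} = 1 - measure P {..q}" if "real_distribution P" "measure P {q} = 0" for P
  proof -
    interpret P: real_distribution P by fact
    have "{q..} = (UNIV - {..q}) \<union> {q}" by auto
    then have "measure P {q..} = measure P (UNIV - {..q}) + measure P {q}"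
      by (simp only:) (rule P.finite_measure_Union, auto)
    also have "measure P (UNIV - {..q}) = 1 - measure P {..q}"
      using P.prob_compl[of "{..q}"] by simp
    finally show ?thesis using that by simp
  qed
  have "\<delta> \<le> c * cdf R q + (1 - c) * cdf Q q"
    using q unfolding is_quantile_def cdf_def by (simp add: mix)
  moreover have "1 - \<delta> \<le> c * (1 - cdf R q) + (1 - c) * (1 - cdf Q q)"
    using q unfolding is_quantile_def cdf_def by (simp add: mix atl[OF R R0] atl[OF Q Q0])
  ultimately show ?thesis by (simp add: algebra_simps)
qed

text \<open>The mean of \<open>D\<close> under \<open>R\<close> is the total mass of
  \<open>Q\<close>, that is 1. For R(q) = \<delta> the weight (c / \<delta>) R(q) is
  \<open>c\<close>, so numerator and denominator coincide.\<close>

lemma mu_eq_1: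
  assumes R: "real_distribution R" and Q: "real_distribution Q" and ac: "absolutely_continuous R Q"
    and D: "is_RN_version R Q D" and c: "0 < c" "c < 1" and \<delta>: "0 < \<delta>" "cdf R q = \<delta>"
  shows "mu R Q D c \<delta> q = 1"
proof -
  interpret R: real_distribution R by fact
  interpret Q: real_distribution Q by fact
  have "(\<integral>\<^sup>+ z. D z \<partial>R) = (\<integral>\<^sup>+ z. RN_deriv R Q z \<partial>R)"
    using D unfolding is_RN_version_def by (intro nn_integral_cong_AE) auto
  also have "\<dots> = emeasure (density R (RN_deriv R Q)) UNIV"
    by (subst emeasure_density) auto
  also have "\<dots> = 1"
    using R.density_RN_deriv[OF ac] Q.emeasure_space_1 by simp
  finally have ER: "enn2real (\<integral>\<^sup>+ z. D z \<partial>R) = 1" by simp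
  \<comment> \<open>The common value must be nonzero for the quotient to be 1.\<close>
  have "0 < c + (1 - c) * enn2real (\<integral>\<^sup>+ z. D z \<partial>Q)"
    using c by (intro add_pos_nonneg) auto
  then show ?thesis using \<delta> by (simp add: mu_def Let_def ER)
qed

section \<open>The conditional CDF at two points near \<delta>\<close>

text \<open>Passing from the p-value to the last entry costs one conditional probability of the
  exceptional event, and \<open>cond_prob_last_near_cdf\<close> costs another. Each is eventually
  below \<epsilon>, which gives the term 2 \<epsilon>.\<close>

lemma (in prob_space) eventually_cond_cdf_near:
  assumes R: "real_distribution R" and Q: "real_distribution Q"
    and c: "0 < c" "c < 1" and cpa: "change_point_array M R Q c X"
    and L: "iid_uniform_randomizers M L"
    and F: "\<And>n. n \<ge> 1 \<Longrightarrow> is_cond_cdf M (order_stat_algebra M X n) (p_value X L n) (F n)"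
    and \<delta>: "\<delta> = c * cdf R q + (1 - c) * cdf Q q" and e: "0 < \<epsilon>"
  shows "AE \<omega> in M. eventually (\<lambda>n.
      F n \<omega> (\<delta> - 3 * \<epsilon>) \<le> cdf Q q + \<epsilon> / (1 - c) + 2 * \<epsilon> \<and>
      cdf Q q - \<epsilon> / (1 - c) - 2 * \<epsilon> \<le> F n \<omega> (\<delta> + 3 * \<epsilon>)) sequentially"
proof -
  let ?G = "order_stat_algebra M X" and ?B = "count_deviation M X R Q c q \<epsilon>"
  let ?E = "\<lambda>n. {\<omega> \<in> space M. X n n \<omega> \<le> q}"
  let ?P = "\<lambda>t n. {\<omega> \<in> space M. p_value X L n \<omega> \<le> t}"
  let ?ce = "\<lambda>n A. real_cond_exp M (?G n) (indicator A)"
  have mX: "X n j \<in> borel_measurable M" if "j \<in> {1..n}" for n j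
    using change_point_array_measurable[OF cpa prob_space_axioms that] .
  have G: "subalgebra M (?G n)" for n by (rule subalgebra_order_stat) (rule mX)
  have B [measurable]: "?B n \<in> events" for n by (rule count_deviation_measurable[OF cpa c])
  have "exp (- 2 * \<epsilon>\<^sup>2) < 1" using e by simp
  then have "summable (\<lambda>n. 4 * exp (- 2 * \<epsilon>\<^sup>2) ^ n)"
    by (intro summable_mult summable_geometric) simp
  then have "summable (\<lambda>n. prob (?B n))"
    by (rule summable_comparison_test'[of _ 1]) (use prob_count_deviation[OF cpa c _ e] in auto)
  from eventually_real_cond_exp_less[OF G B this e]
  have Z: "AE \<omega> in M. eventually (\<lambda>n. ?ce n (?B n) \<omega> < \<epsilon>) sequentially" .
  \<comment> \<open>\<open>F n\<close> equals the conditional probability only almost surely at each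
    fixed point. Two points per row suffice here, and the null sets of the countably many rows are
    united at the end.\<close>
  have row: "AE \<omega> in M. n \<ge> 1 \<and> 1 < \<epsilon> * real n \<longrightarrow>
      F n \<omega> (\<delta> - 3 * \<epsilon>) \<le> cdf Q q + \<epsilon> / (1 - c) + 2 * ?ce n (?B n) \<omega> \<and>
      cdf Q q - \<epsilon> / (1 - c) - 2 * ?ce n (?B n) \<omega> \<le> F n \<omega> (\<delta> + 3 * \<epsilon>)" for n
  proof (cases "n \<ge> 1 \<and> 1 < \<epsilon> * real n")
    case True
    then have n: "1 \<le> n" "1 < \<epsilon> * real n" by auto
    interpret finite_measure_subalgebra M "?G n" by unfold_locales (rule G)
    have Ln [measurable]: "L n \<in> borel_measurable M"
      using L n unfolding iid_uniform_randomizers_def indep_vars_def by auto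
    have "AE x in distr M borel (L n). 0 < x \<and> x < 1"
    proof -
      have "distr M borel (L n) = uniform_measure lborel {0<..<1}"
        using L n unfolding iid_uniform_randomizers_def by auto
      then show ?thesis by (simp only:) (rule AE_uniform_measureI, auto)
    qed
    then have L01: "AE \<omega> in M. 0 < L n \<omega> \<and> L n \<omega> < 1" by (rule AE_distrD[OF Ln])
    have Xn [measurable]: "X n n \<in> borel_measurable M" using mX n by auto
    have [measurable]: "(\<lambda>\<omega>. of_bool (X n i \<omega> < X n n \<omega>) :: real) \<in> borel_measurable M"
      "(\<lambda>\<omega>. of_bool (X n i \<omega> = X n n \<omega>) :: real) \<in> borel_measurable M" if "i \<in> {1..n}" for i
    proof -
      note [measurable] = mX[OF that]
      show "(\<lambda>\<omega>. of_bool (X n i \<omega> < X n n \<omega>) :: real) \<in> borel_measurable M"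
        "(\<lambda>\<omega>. of_bool (X n i \<omega> = X n n \<omega>) :: real) \<in> borel_measurable M" by measurable
    qed
    then have pm [measurable]: "p_value X L n \<in> borel_measurable M"
      unfolding p_value_def[abs_def]
      by (intro borel_measurable_divide borel_measurable_add borel_measurable_times borel_measurable_sum
          Ln borel_measurable_const)
    have [measurable]: "?E n \<in> events" "?P t n \<in> events" for t by measurable
    have iE: "integrable M (indicator (?E n) :: _ \<Rightarrow> real)" and iB: "integrable M (indicator (?B n) :: _ \<Rightarrow> real)"
      and iP: "integrable M (indicator (?P t n) :: _ \<Rightarrow> real)" for t
      by (rule integrable_indicator_real; measurable)+
    have Fc: "AE \<omega> in M. F n \<omega> t = ?ce n (?P t n) \<omega>" for t
      using F[OF n(1)] unfolding is_cond_cdf_def by auto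
    note near = count_near_mixture_cdf[OF c _ _ R Q n(2), where q = q and X = X and M = M, folded \<delta>]
    \<comment> \<open>Off the exceptional event more than (\<delta> - 3\<epsilon>) n entries are at
      most \<open>q\<close>, so a p-value of at most \<delta> - 3\<epsilon> forces the last entry to
      be at most \<open>q\<close>.\<close>
    have "AE \<omega> in M. indicator (?P (\<delta> - 3 * \<epsilon>) n) \<omega> \<le> (indicator (?E n) \<omega> + indicator (?B n) \<omega> :: real)"
      using L01 AE_space
    proof eventually_elim
      case (elim \<omega>)
      show ?case
      proof (cases "\<omega> \<in> ?B n")
        case False
        then have "\<bar>(\<Sum>i=1..n. of_bool (X n i \<omega> \<le> q)) - \<delta> * real n\<bar> < 3 * \<epsilon> * real n"
          using near[of \<omega>] elim by blast
        then have "\<not> (\<Sum>i=1..n. of_bool (X n i \<omega> \<le> q)) \<le> (\<delta> - 3 * \<epsilon>) * real n"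
          unfolding left_diff_distrib by linarith
        then have "\<omega> \<in> ?P (\<delta> - 3 * \<epsilon>) n \<Longrightarrow> \<omega> \<in> ?E n"
          using p_value_le_imp[of X L n \<omega> "\<delta> - 3 * \<epsilon>" q] elim n by (simp del: sum_of_bool_eq)
        then show ?thesis by (simp add: indicator_def)
      qed (auto simp: indicator_def)
    qed
    then have "AE \<omega> in M. ?ce n (?P (\<delta> - 3 * \<epsilon>) n) \<omega>
        \<le> real_cond_exp M (?G n) (\<lambda>\<omega>. indicator (?E n) \<omega> + indicator (?B n) \<omega>) \<omega>"
      by (rule real_cond_exp_mono) (use iE iB iP in auto)
    moreover have "AE \<omega> in M. real_cond_exp M (?G n) (\<lambda>\<omega>. indicator (?E n) \<omega> + indicator (?B n) \<omega>) \<omega>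
        = ?ce n (?E n) \<omega> + ?ce n (?B n) \<omega>"
      by (rule real_cond_exp_add[OF iE iB])
    \<comment> \<open>Conversely, off the exceptional event fewer than (\<delta> + 3\<epsilon>) n
      entries are at most \<open>q\<close>, which bounds the p-value whenever the last entry is
      among them.\<close>
    moreover have "AE \<omega> in M. indicator (?E n) \<omega> - indicator (?B n) \<omega> \<le> (indicator (?P (\<delta> + 3 * \<epsilon>) n) \<omega> :: real)"
      using L01 AE_space
    proof eventually_elim
      case (elim \<omega>)
      show ?case
      proof (cases "\<omega> \<in> ?B n")
        case False
        then have "\<bar>(\<Sum>i=1..n. of_bool (X n i \<omega> \<le> q)) - \<delta> * real n\<bar> < 3 * \<epsilon> * real n"
          using near[of \<omega>] elim by blast
        then have "(\<Sum>i=1..n. of_bool (X n i \<omega> \<le> q)) \<le> (\<delta> + 3 * \<epsilon>) * real n"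
          unfolding distrib_right by linarith
        then have "\<omega> \<in> ?E n \<Longrightarrow> \<omega> \<in> ?P (\<delta> + 3 * \<epsilon>) n"
          using p_value_leI[of X n \<omega> q "\<delta> + 3 * \<epsilon>" L] elim n by (simp del: sum_of_bool_eq)
        then show ?thesis by (simp add: indicator_def)
      qed (auto simp: indicator_def)
    qed
    then have "AE \<omega> in M. real_cond_exp M (?G n) (\<lambda>\<omega>. indicator (?E n) \<omega> - indicator (?B n) \<omega>) \<omega>
        \<le> ?ce n (?P (\<delta> + 3 * \<epsilon>) n) \<omega>"
      by (rule real_cond_exp_mono) (use iE iB iP in auto)
    moreover have "AE \<omega> in M. real_cond_exp M (?G n) (\<lambda>\<omega>. indicator (?E n) \<omega> - indicator (?B n) \<omega>) \<omega>
        = ?ce n (?E n) \<omega> - ?ce n (?B n) \<omega>"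
      by (rule real_cond_exp_diff[OF iE iB])
    moreover note cond_prob_last_near_cdf[OF cpa c n(1) e Q, of q] Fc[of "\<delta> - 3 * \<epsilon>"] Fc[of "\<delta> + 3 * \<epsilon>"]
    ultimately show ?thesis
      by eventually_elim (auto simp: abs_le_iff)
  qed auto
  have large: "eventually (\<lambda>n. n \<ge> 1 \<and> 1 < \<epsilon> * real n) sequentially"
  proof -
    obtain N :: nat where N: "1 / \<epsilon> < real N" using reals_Archimedean2 by blast
    have "n \<ge> 1 \<and> 1 < \<epsilon> * real n" if "n \<ge> max N 1" for n
    proof -
      have "1 / \<epsilon> < real n" using N that by linarith
      then show ?thesis using that e by (simp add: field_simps)
    qed
    then show ?thesis unfolding eventually_sequentially by blast
  qed
  have "AE \<omega> in M. \<forall>n. n \<ge> 1 \<and> 1 < \<epsilon> * real n \<longrightarrow>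
      F n \<omega> (\<delta> - 3 * \<epsilon>) \<le> cdf Q q + \<epsilon> / (1 - c) + 2 * ?ce n (?B n) \<omega> \<and>
      cdf Q q - \<epsilon> / (1 - c) - 2 * ?ce n (?B n) \<omega> \<le> F n \<omega> (\<delta> + 3 * \<epsilon>)"
    using row by (simp add: AE_all_countable)
  with Z show ?thesis
  proof eventually_elim
    case (elim \<omega>)
    note all = elim(2)
    show ?case
      using elim(1) large
    proof eventually_elim
      case (elim n)
      then have "F n \<omega> (\<delta> - 3 * \<epsilon>) \<le> cdf Q q + \<epsilon> / (1 - c) + 2 * ?ce n (?B n) \<omega>"
        "cdf Q q - \<epsilon> / (1 - c) - 2 * ?ce n (?B n) \<omega> \<le> F n \<omega> (\<delta> + 3 * \<epsilon>)"
        using all by blast+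
      with elim(1) show ?case by (intro conjI; linarith)
    qed
  qed
qed

section \<open>Choice of \<epsilon> and distance from the identity\<close>

theorem theorem2:
  fixes R Q :: "real measure" and D :: "real \<Rightarrow> ennreal" and c \<delta> q :: real
    and M :: "'a measure" and X :: "nat \<Rightarrow> nat \<Rightarrow> 'a \<Rightarrow> real" and L :: "nat \<Rightarrow> 'a \<Rightarrow> real"
    and F :: "nat \<Rightarrow> 'a \<Rightarrow> real \<Rightarrow> real"
  assumes "real_distribution R" and "real_distribution Q"
    and "absolutely_continuous R Q"
    and "is_RN_version R Q D" and "\<And>x. D x < \<infinity>"
    and "0 < c" and "c < 1"
    and "prob_space M"
    and "change_point_array M R Q c X"
    and "0 < \<delta>" and "\<delta> < 1"
    and "is_quantile (mixture c R Q) \<delta> q"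
    and "\<And>x. is_quantile (mixture c R Q) \<delta> x \<Longrightarrow> x = q"
    and "isCont (cdf R) q"
    and "(\<integral>\<^sup>+ z. D z \<partial>Q) < \<infinity>"
    and "mu R Q D c \<delta> q \<noteq> 1"
    and "iid_uniform_randomizers M L"
    and "randomizers_indep_array M L X"
    and "\<And>n. n \<ge> 1 \<Longrightarrow> is_cond_cdf M (order_stat_algebra M X n) (p_value X L n) (F n)"
  shows "AE \<omega> in M. liminf (\<lambda>n. SUP t\<in>{0..1}. ereal \<bar>F n \<omega> t - t\<bar>) > 0"
proof -
  interpret prob_space M by fact
  interpret Q: real_distribution Q by fact
  have \<delta>: "\<delta> = c * cdf R q + (1 - c) * cdf Q q"
    by (rule quantile_mixture_eq) fact+
  have "cdf R q \<noteq> \<delta>" using mu_eq_1 assms by blast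
  \<comment> \<open>\<delta> is a convex combination of R(q) and Q(q) with positive weight
    \<open>c\<close> on R(q), so Q(q) = \<delta> would give R(q) = \<delta>.\<close>
  then have ne: "cdf Q q \<noteq> \<delta>"
  proof (rule contrapos_nn)
    assume "cdf Q q = \<delta>"
    then have "c * cdf R q = c * \<delta>" using \<delta>
      unfolding \<open>cdf Q q = \<delta>\<close> by (auto simp: algebra_simps)
    then show "cdf R q = \<delta>" using \<open>0 < c\<close> by simp
  qed
  \<comment> \<open>The gap between Q(q) and \<delta> is to be split as \<epsilon> / (1 - c) +
    2\<epsilon> for the error of the conditional CDF, 3\<epsilon> for the shift of its argument, and
    \<epsilon> as the remaining margin.\<close>
  define k where "k = 1 / (1 - c) + 6"
  have k: "6 < k" using \<open>c < 1\<close> by (simp add: k_def)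
  define \<epsilon> where "\<epsilon> = \<bar>cdf Q q - \<delta>\<bar> / k"
  have e: "0 < \<epsilon>" using ne k by (simp add: \<epsilon>_def)
  have ke: "\<epsilon> / (1 - c) + 6 * \<epsilon> = \<bar>cdf Q q - \<delta>\<bar>"
  proof -
    have "\<epsilon> / (1 - c) + 6 * \<epsilon> = k * \<epsilon>" by (simp add: k_def algebra_simps)
    then show ?thesis using k by (simp add: \<epsilon>_def)
  qed
  have e6: "6 * \<epsilon> < \<bar>cdf Q q - \<delta>\<bar>"
    using ke e \<open>c < 1\<close> by (smt (verit) divide_pos_pos)
  have Q01: "0 \<le> cdf Q q" "cdf Q q \<le> 1" by (simp_all add: cdf_def)
  have SUP: "ereal \<epsilon> \<le> (SUP t\<in>{0..1}. ereal \<bar>f t - t\<bar>)" if "s \<in> {0..1}" "\<epsilon> \<le> \<bar>f s - s\<bar>" for f s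
    using that by (intro SUP_upper2[of s]) auto
  have "AE \<omega> in M. eventually (\<lambda>n.
      F n \<omega> (\<delta> - 3 * \<epsilon>) \<le> cdf Q q + \<epsilon> / (1 - c) + 2 * \<epsilon> \<and>
      cdf Q q - \<epsilon> / (1 - c) - 2 * \<epsilon> \<le> F n \<omega> (\<delta> + 3 * \<epsilon>)) sequentially"
    by (rule eventually_cond_cdf_near[OF assms(1,2,6,7,9,17,19) \<delta> e])
  then show ?thesis
  proof eventually_elim
    case (elim \<omega>)
    then have "eventually (\<lambda>n. ereal \<epsilon> \<le> (SUP t\<in>{0..1}. ereal \<bar>F n \<omega> t - t\<bar>)) sequentially"
    proof eventually_elim
      case (elim n)
      show ?case
      \<comment> \<open>For Q(q) < \<delta> the conditional CDF is too small at \<delta> -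
        3\<epsilon>, otherwise too large at \<delta> + 3\<epsilon>. Since 6\<epsilon> is less than
        the gap and Q(q) lies in [0,1], the chosen point stays in [0,1].\<close>
      proof (cases "cdf Q q < \<delta>")
        case True
        then have "0 \<le> \<delta> - 3 * \<epsilon>" "\<delta> - 3 * \<epsilon> \<le> 1" "\<epsilon> \<le> \<bar>F n \<omega> (\<delta> - 3 * \<epsilon>) - (\<delta> - 3 * \<epsilon>)\<bar>"
          using conjunct1[OF elim] ke e e6 Q01 assms(10,11) by linarith+
        then show ?thesis by (intro SUP[of "\<delta> - 3 * \<epsilon>"]) simp_all
      next
        case False
        then have "0 \<le> \<delta> + 3 * \<epsilon>" "\<delta> + 3 * \<epsilon> \<le> 1" "\<epsilon> \<le> \<bar>F n \<omega> (\<delta> + 3 * \<epsilon>) - (\<delta> + 3 * \<epsilon>)\<bar>"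
          using conjunct2[OF elim] ne ke e e6 Q01 assms(10,11) by linarith+
        then show ?thesis by (intro SUP[of "\<delta> + 3 * \<epsilon>"]) simp_all
      qed
    qed
    then have "ereal \<epsilon> \<le> liminf (\<lambda>n. SUP t\<in>{0..1}. ereal \<bar>F n \<omega> t - t\<bar>)"
      by (rule Liminf_bounded)
    moreover have "0 < ereal \<epsilon>" using e by simp
    ultimately show ?case by (rule less_le_trans[rotated])
  qed
qed

end
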